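(* Let $k\geq 2$ be an integer and $R$ a commutative ring. Let $A_1(z),\dots,A_d(z)\in R[[z]]$ be $k$-regular series, let $L_i(x_1,\dots,x_d)=\sum_{j=1}^d c_{ij}(z)x_j$ ($i=1,\dots,d$) be linear forms with coefficients $c_{ij}(z)\in R[z]$, and let $\alpha_1,\dots,\alpha_d\in R$ satisfy $\alpha_i=A_i(0)+\sum_{j=1}^d c_{ij}(0)\alpha_j$ for $i=1,\dots,d$. Then the system $$U_i(z)=A_i(z)+L_i\bigl(U_1(z^k),\dots,U_d(z^k)\bigr),\qquad i=1,\dots,d,$$ has a unique solution $(U_1,\dots,U_d)\in R[[z]]^d$ with $U_i(0)=\alpha_i$ for $i=1,\dots,d$, and $U_1,\dots,U_d$ are all $k$-regular.
   Context: For $0\leq i\leq k-1$, let $\rho(i)$ be the $R$-linear map on $R[[z]]$ given by $\rho(i)\left(\sum_n a(n)z^n\right)=\sum_n a(i+nk)z^n$. The $k$-kernel of $A\in R[[z]]$ is the smallest $R$-submodule of $R[[z]]$ containing $A$ and stable under $\rho(0),\dots,\rho(k-1)$; $A$ is $k$-regular if its $k$-kernel is a finitely generated $R$-module. *)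

theory Defs
  imports
    "HOL-Computational_Algebra.Formal_Power_Series"
    "HOL-Computational_Algebra.Polynomial_FPS"
    "HOL-Library.FuncSet"
begin

definition fps_scale :: "'a::comm_ring_1 \<Rightarrow> 'a fps \<Rightarrow> 'a fps" where
  "fps_scale c f = fps_const c * f"

interpretation fps_module: module fps_scale
  by standard (simp_all add: fps_scale_def algebra_simps flip: fps_const_add fps_const_mult)

definition rho :: "nat \<Rightarrow> nat \<Rightarrow> 'a fps \<Rightarrow> 'a fps" where
  "rho k i f = Abs_fps (\<lambda>n. fps_nth f (i + n * k))"

definition k_kernel :: "nat \<Rightarrow> 'a::comm_ring_1 fps \<Rightarrow> 'a fps set" where
  "k_kernel k A = \<Inter> {M. fps_module.subspace M \<and> A \<in> M \<and> (\<forall>i<k. \<forall>f\<in>M. rho k i f \<in> M)}"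

definition k_regular :: "nat \<Rightarrow> 'a::comm_ring_1 fps \<Rightarrow> bool" where
  "k_regular k A \<longleftrightarrow> (\<exists>B. finite B \<and> k_kernel k A = fps_module.span B)"

(* The U i with i outside {1..d} are not constrained; d-tuples are the extensional functions. *)
definition mahler_solution ::
    "nat \<Rightarrow> nat \<Rightarrow> (nat \<Rightarrow> 'a::comm_ring_1 fps) \<Rightarrow> (nat \<Rightarrow> nat \<Rightarrow> 'a poly) \<Rightarrow> (nat \<Rightarrow> 'a)
      \<Rightarrow> (nat \<Rightarrow> 'a fps) \<Rightarrow> bool" where
  "mahler_solution k d A c \<alpha> U \<longleftrightarrow>
     (\<forall>i\<in>{1..d}. U i = A i + (\<Sum>j=1..d. fps_of_poly (c i j) * (U j oo fps_X ^ k))) \<and>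
     (\<forall>i\<in>{1..d}. fps_nth (U i) 0 = \<alpha> i)"

end

theory Submission
  imports Defs "HOL.Hull"
begin

text \<open>The span of the series \<open>z\<^sup>a h\<close>, with \<open>a\<close> bounded and \<open>h\<close> a generator of the \<open>k\<close>-kernel of some
  \<open>A j\<close> or some \<open>U j\<close>, is finitely generated and stable under all \<open>\<rho>(i)\<close>. Over a Noetherian ring
  this suffices, because the \<open>k\<close>-kernel of \<open>U i\<close> is a submodule of it. For arbitrary \<open>R\<close>, only
  finitely many coefficients are involved in this stability; they generate a subring which is
  Noetherian by Hilbert's basis theorem, and finite generation over the subring passes to \<open>R\<close>.\<close>

section \<open>Submodules over a subring, and Noetherian modules\<close>

definition subring :: "'a::comm_ring_1 set \<Rightarrow> bool" where
  "subring S \<longleftrightarrow> 1 \<in> S \<and> (\<forall>x\<in>S. - x \<in> S) \<and> (\<forall>x\<in>S. \<forall>y\<in>S. x + y \<in> S \<and> x * y \<in> S)"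

definition submod_over :: "('a \<Rightarrow> 'b \<Rightarrow> 'b) \<Rightarrow> 'a::comm_ring_1 set \<Rightarrow> 'b::ab_group_add set \<Rightarrow> bool" where
  "submod_over sc S M \<longleftrightarrow> 0 \<in> M \<and> (\<forall>x\<in>M. \<forall>y\<in>M. x + y \<in> M) \<and> (\<forall>s\<in>S. \<forall>x\<in>M. sc s x \<in> M)"

definition noetherian_over ::
    "('a \<Rightarrow> 'b \<Rightarrow> 'b) \<Rightarrow> 'a::comm_ring_1 set \<Rightarrow> 'b::ab_group_add set \<Rightarrow> bool" where
  "noetherian_over sc S V \<longleftrightarrow>
     (\<forall>M. submod_over sc S M \<and> M \<subseteq> V \<longrightarrow> (\<exists>F. finite F \<and> M = submod_over sc S hull F))"

abbreviation noetherian_subring :: "'a::comm_ring_1 set \<Rightarrow> bool" where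
  "noetherian_subring S \<equiv> subring S \<and> noetherian_over (*) S S"

lemma subring_zero: "subring S \<Longrightarrow> 0 \<in> S"
  unfolding subring_def by (metis add.right_inverse)

lemma subring_hull: "subring (subring hull E)"
  by (rule hull_in) (auto simp: subring_def)

lemma submod_hull: "submod_over sc S (submod_over sc S hull G)"
  by (rule hull_in) (auto simp: submod_over_def)

lemma submod_subset: "submod_over sc S M \<Longrightarrow> S' \<subseteq> S \<Longrightarrow> submod_over sc S' M"
  by (auto simp: submod_over_def)

lemma submod_Int: "submod_over sc S M \<Longrightarrow> submod_over sc S N \<Longrightarrow> submod_over sc S (M \<inter> N)"
  by (auto simp: submod_over_def)

lemma module_times: "module ((*) :: 'a::comm_ring_1 \<Rightarrow> 'a \<Rightarrow> 'a)"
  by standard (simp_all add: algebra_simps)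

section \<open>Finitely generated modules over a Noetherian subring\<close>

context module
begin

lemma submod_diff:
  assumes "subring S" "submod_over scale S M" "x \<in> M" "y \<in> M"
  shows "x - y \<in> M"
proof -
  have "- 1 \<in> S" using assms(1) by (auto simp: subring_def)
  then have "scale (- 1) y \<in> M" using assms by (auto simp: submod_over_def)
  then have "x + scale (- 1) y \<in> M" using assms by (auto simp: submod_over_def)
  then show ?thesis by simp
qed

text \<open>Combined with \<open>hull_minimal\<close>, this reduces a claim that a linear map sends
  a generated submodule into \<open>M\<close> to a check on generators.\<close>

lemma submod_vimage_linear:
  assumes M: "submod_over scale S M"
    and "f 0 = 0" "\<And>x y. f (x + y) = f x + f y" "\<And>s x. f (scale' s x) = scale s (f x)"
  shows "submod_over scale' S {x. f x \<in> M}"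
  using assms by (auto simp: submod_over_def)

text \<open>The elements \<open>scale s g + w\<close> already form a submodule containing
  \<open>g\<close> and \<open>G\<close>. This splits off one generator; with
  \<open>g = x ^ n\<close> it splits off the leading term.\<close>

lemma submod_hull_insert:
  assumes S: "subring S" and y: "y \<in> submod_over scale S hull (insert g G)"
  shows "\<exists>s\<in>S. \<exists>w\<in>submod_over scale S hull G. y = scale s g + w"
proof -
  define H where "H = submod_over scale S hull G"
  have H: "submod_over scale S H" unfolding H_def by (rule submod_hull)
  define Y where "Y = {y. \<exists>s\<in>S. \<exists>w\<in>H. y = scale s g + w}"
  have YI: "scale s g + w \<in> Y" if "s \<in> S" "w \<in> H" for s w
    using that by (auto simp: Y_def)
  have "submod_over scale S Y"
    unfolding submod_over_def
  proof (intro conjI ballI)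
    show "0 \<in> Y"
      using YI[of 0 0] subring_zero[OF S] H by (simp add: submod_over_def)
  next
    fix x y assume "x \<in> Y" "y \<in> Y"
    then obtain s w s' w' where *: "s \<in> S" "w \<in> H" "s' \<in> S" "w' \<in> H"
      "x = scale s g + w" "y = scale s' g + w'" by (auto simp: Y_def)
    then have "x + y = scale (s + s') g + (w + w')" by (simp add: scale_left_distrib)
    moreover have "s + s' \<in> S" "w + w' \<in> H"
      using * S H by (auto simp: subring_def submod_over_def)
    ultimately show "x + y \<in> Y" using YI by metis
  next
    fix t x assume "t \<in> S" "x \<in> Y"
    then obtain s w where *: "s \<in> S" "w \<in> H" "x = scale s g + w" by (auto simp: Y_def)
    then have "scale t x = scale (t * s) g + scale t w" by (simp add: scale_right_distrib)
    moreover have "t * s \<in> S" "scale t w \<in> H"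
      using * \<open>t \<in> S\<close> S H by (auto simp: subring_def submod_over_def)
    ultimately show "scale t x \<in> Y" using YI by metis
  qed
  moreover have "insert g G \<subseteq> Y"
  proof
    fix h assume "h \<in> insert g G"
    then consider "h = g" | "h \<in> G" by auto
    then show "h \<in> Y"
    proof cases
      case 1
      then show ?thesis using YI[of 1 0] S H by (simp add: subring_def submod_over_def)
    next
      case 2
      then have "h \<in> H" unfolding H_def by (rule hull_inc)
      then show ?thesis using YI[of 0 h] subring_zero[OF S] by simp
    qed
  qed
  ultimately show ?thesis
    using hull_minimal[of "insert g G" Y "submod_over scale S"] y by (auto simp: Y_def H_def)
qed

text \<open>The witnesses \<open>w\<close> can be added and scaled along with the coefficients. For
  \<open>g = x ^ n\<close> and \<open>W\<close> the elements of lower degree, this is the ideal of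
  leading coefficients from the proof of Hilbert's basis theorem.\<close>

lemma submod_leading_coeffs:
  assumes S: "subring S" and W: "submod_over scale S W" and M: "submod_over scale S M"
  shows "submod_over (*) S {s\<in>S. \<exists>w\<in>W. scale s g + w \<in> M}" (is "submod_over _ _ ?L")
  unfolding submod_over_def
proof (intro conjI ballI)
  show "0 \<in> ?L"
    using subring_zero[OF S] W M by (auto simp: submod_over_def intro!: bexI[of _ 0])
next
  fix x y assume "x \<in> ?L" "y \<in> ?L"
  then obtain w w' where *: "x \<in> S" "y \<in> S" "w \<in> W" "w' \<in> W" "scale x g + w \<in> M" "scale y g + w' \<in> M"
    by auto
  have "scale (x + y) g + (w + w') = (scale x g + w) + (scale y g + w')"
    by (simp add: scale_left_distrib)
  then have "scale (x + y) g + (w + w') \<in> M" using * M unfolding submod_over_def by metis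
  then show "x + y \<in> ?L" using * S W by (auto simp: subring_def submod_over_def)
next
  fix t x assume "t \<in> S" "x \<in> ?L"
  then obtain w where *: "x \<in> S" "w \<in> W" "scale x g + w \<in> M" by auto
  have "scale (t * x) g + scale t w = scale t (scale x g + w)"
    by (simp add: scale_right_distrib)
  then have "scale (t * x) g + scale t w \<in> M"
    using * M \<open>t \<in> S\<close> unfolding submod_over_def by metis
  then show "t * x \<in> ?L" using * S W \<open>t \<in> S\<close> by (auto simp: subring_def submod_over_def)
qed

text \<open>Induction on the generators: a submodule \<open>M\<close> is controlled by the ideal
  \<open>I\<close> of its coefficients at the new generator \<open>g\<close> and by its part inside
  the module \<open>H\<close> of the old generators. The first is finitely generated since
  \<open>S\<close> is Noetherian, the second by the induction hypothesis.\<close>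

lemma noetherian_hull_finite:
  assumes S: "noetherian_subring S" and "finite G"
  shows "noetherian_over scale S (submod_over scale S hull G)"
  using \<open>finite G\<close>
proof (induction G rule: finite_induct)
  case empty
  have "submod_over scale S {0}" by (auto simp: submod_over_def)
  then have "submod_over scale S hull {} \<subseteq> {0}" by (intro hull_minimal) auto
  moreover have "0 \<in> submod_over scale S hull {}"
    using submod_hull[of scale S "{}"] by (simp add: submod_over_def)
  ultimately have "submod_over scale S hull {} = {0}" by auto
  then show ?case
    unfolding noetherian_over_def
    by (metis finite.emptyI submod_over_def subset_singletonD empty_iff)
next
  case (insert g G)
  have Sr: "subring S" using S by simp
  define H where "H = submod_over scale S hull G"
  have H: "submod_over scale S H" unfolding H_def by (rule submod_hull)
  show ?case
    unfolding noetherian_over_def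
  proof (intro allI impI, elim conjE)
    fix M assume M: "submod_over scale S M" and sub: "M \<subseteq> submod_over scale S hull (insert g G)"
    define I where "I = {s\<in>S. \<exists>w\<in>H. scale s g + w \<in> M}"
    have "submod_over (*) S I"
      unfolding I_def by (rule submod_leading_coeffs) (use Sr H M in auto)
    moreover have "I \<subseteq> S" by (auto simp: I_def)
    ultimately obtain F0 where F0: "finite F0" "I = submod_over (*) S hull F0"
      using S unfolding noetherian_over_def by blast
    have "F0 \<subseteq> I" unfolding F0(2) by (rule hull_subset)
    then have "\<forall>s\<in>F0. \<exists>w. w \<in> H \<and> scale s g + w \<in> M" by (auto simp: I_def)
    then obtain w where w: "\<forall>s\<in>F0. w s \<in> H \<and> scale s g + w s \<in> M" by metis
    obtain F1 where F1: "finite F1" "M \<inter> H = submod_over scale S hull F1"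
      using insert.IH submod_Int[OF M H] unfolding noetherian_over_def H_def by blast
    \<comment> \<open>Lifts to \<open>M\<close> of the generators of \<open>I\<close>, together with
      generators of \<open>M \<inter> H\<close>.\<close>
    define F where "F = (\<lambda>s. scale s g + w s) ` F0 \<union> F1"
    define K where "K = submod_over scale S hull F"
    have K: "submod_over scale S K" unfolding K_def by (rule submod_hull)
    have "F1 \<subseteq> M" using F1(2) hull_subset[of F1 "submod_over scale S"] by blast
    then have "F \<subseteq> M" using w by (auto simp: F_def)
    then have KM: "K \<subseteq> M" unfolding K_def using M by (rule hull_minimal)
    have F1K: "M \<inter> H \<subseteq> K"
      unfolding F1(2) K_def by (rule hull_mono) (simp add: F_def)
    \<comment> \<open>The coefficients at \<open>g\<close> occurring in \<open>K\<close> form an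
      ideal as well, so it is enough to find the generators of \<open>I\<close> among them.\<close>
    have "F0 \<subseteq> {s\<in>S. \<exists>w\<in>H. scale s g + w \<in> K}"
    proof
      fix s assume s: "s \<in> F0"
      then have "scale s g + w s \<in> K" unfolding K_def by (intro hull_inc) (simp add: F_def)
      then show "s \<in> {s\<in>S. \<exists>w\<in>H. scale s g + w \<in> K}" using s w \<open>F0 \<subseteq> I\<close> \<open>I \<subseteq> S\<close> by auto
    qed
    then have IK: "I \<subseteq> {s\<in>S. \<exists>w\<in>H. scale s g + w \<in> K}"
      unfolding F0(2) by (rule hull_minimal) (rule submod_leading_coeffs[OF Sr H K])
    have "M \<subseteq> K"
    proof
      fix y assume y: "y \<in> M"
      then obtain s v where sv: "s \<in> S" "v \<in> H" "y = scale s g + v"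
        using submod_hull_insert[OF Sr] sub unfolding H_def by blast
      then have "s \<in> I" using y by (auto simp: I_def)
      then obtain v' where v': "v' \<in> H" "scale s g + v' \<in> K" using IK by blast
      \<comment> \<open>An element of \<open>K\<close> with the same coefficient at \<open>g\<close>
        is subtracted from \<open>y\<close>; the difference \<open>v - v'\<close> has no
        \<open>g\<close> term left and lies in \<open>M \<inter> H\<close>.\<close>
      have "v - v' \<in> H" using submod_diff[OF Sr H] sv v' by blast
      moreover have "y - (scale s g + v') \<in> M" using submod_diff[OF Sr M y] v' KM by blast
      ultimately have "v - v' \<in> K" using F1K sv by auto
      then have "(v - v') + (scale s g + v') \<in> K" using v' K unfolding submod_over_def by blast
      then show "y \<in> K" using sv by (simp add: algebra_simps)
    qed
    then have "M = K" using KM by blast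
    then show "\<exists>F. finite F \<and> M = submod_over scale S hull F"
      unfolding K_def using F0(1) F1(1) by (intro exI[of _ F]) (auto simp: F_def)
  qed
qed

end

section \<open>Finitely generated subrings are Noetherian\<close>

text \<open>Division with remainder, as for ideals of the integers: \<open>M\<close> is generated by
  the image of the least positive \<open>n\<close> whose image lies in \<open>M\<close>. The map
  \<open>of_int\<close> may fail to be injective, so the argument runs on integer
  representatives.\<close>

lemma noetherian_prime_subring:
  "noetherian_subring (range of_int :: 'a::comm_ring_1 set)"
proof
  show "subring (range of_int :: 'a set)"
    unfolding subring_def
  proof (intro conjI ballI)
    show "1 \<in> (range of_int :: 'a set)" using rangeI[of of_int 1] by simp
  next
    fix x :: 'a assume "x \<in> range of_int"
    then obtain a where "x = of_int a" by blast
    then show "- x \<in> range of_int" using rangeI[of of_int "- a"] by simp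
  next
    fix x y :: 'a assume "x \<in> range of_int" "y \<in> range of_int"
    then obtain a b where "x = of_int a" "y = of_int b" by blast
    then show "x + y \<in> range of_int" "x * y \<in> range of_int"
      using rangeI[of of_int "a + b"] rangeI[of of_int "a * b"] by simp_all
  qed
  show "noetherian_over (*) (range of_int) (range of_int :: 'a set)"
    unfolding noetherian_over_def
  proof (intro allI impI, elim conjE)
    fix M :: "'a set"
    assume M: "submod_over (*) (range of_int) M" and sub: "M \<subseteq> range of_int"
    have mult: "of_int z * x \<in> M" if "x \<in> M" for z x
      using M that unfolding submod_over_def by blast
    have add: "x + y \<in> M" if "x \<in> M" "y \<in> M" for x y
      using M that unfolding submod_over_def by blast
    \<comment> \<open>Positivity is asked of \<open>n\<close> itself; its image may be zero in
      positive characteristic.\<close>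
    define P where "P n \<longleftrightarrow> n > 0 \<and> (of_nat n :: 'a) \<in> M" for n
    show "\<exists>F. finite F \<and> M = submod_over (*) (range of_int) hull F"
    proof (cases "\<exists>n. P n")
      case True
      define m where "m = (LEAST n. P n)"
      have m: "P m" unfolding m_def by (rule LeastI_ex[OF True])
      define K where "K = submod_over (*) (range of_int) hull {of_nat m :: 'a}"
      have "K \<subseteq> M" unfolding K_def using m M by (intro hull_minimal) (auto simp: P_def)
      moreover have "M \<subseteq> K"
      proof
        fix x assume x: "x \<in> M"
        then obtain z where z: "x = of_int z" using sub by blast
        have e: "(of_int (z mod int m) :: 'a) = of_int z - of_int (z div int m) * of_nat m"
          by (metis add_diff_cancel_left' div_mult_mod_eq of_int_add of_int_mult of_int_of_nat_eq)
        have "of_int (z mod int m) = x + of_int (- (z div int m)) * of_nat m"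
          by (simp add: e z)
        also have "\<dots> \<in> M" using x m by (intro add mult) (auto simp: P_def)
        \<comment> \<open>The remainder is below \<open>m\<close> and its image lies in
          \<open>M\<close>, so minimality of \<open>m\<close> forces it to be zero.\<close>
        finally have "of_nat (nat (z mod int m)) \<in> M" using m by (simp add: P_def)
        moreover have "nat (z mod int m) < m" using m
          by (simp add: P_def nat_less_iff)
        then have "\<not> P (nat (z mod int m))" unfolding m_def by (rule not_less_Least)
        ultimately have "z mod int m = 0" using m
          by (metis P_def bot_nat_0.not_eq_extremum of_nat_0_less_iff pos_mod_sign nat_eq_iff2
              order_antisym_conv nat_0_iff)
        then have "x = of_int (z div int m) * of_nat m" using e z by simp
        moreover have "of_nat m \<in> K" unfolding K_def by (rule hull_inc) simp
        ultimately show "x \<in> K"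
          using submod_hull[of "(*)" "range of_int" "{of_nat m :: 'a}"]
          unfolding K_def submod_over_def by blast
      qed
      ultimately show ?thesis unfolding K_def by blast
    next
      case False
      have "M \<subseteq> {0}"
      proof
        fix x assume x: "x \<in> M"
        then obtain z where z: "x = of_int z" using sub by blast
        \<comment> \<open>Multiplying by the sign gives a natural representative, to which the
          failure of \<open>P\<close> applies.\<close>
        have "of_int (sgn z) * x = of_nat (nat \<bar>z\<bar>)"
          by (simp add: z flip: of_int_mult sgn_mult_abs) (simp add: abs_sgn mult.commute)
        then have "of_nat (nat \<bar>z\<bar>) \<in> M" using mult[OF x, of "sgn z"] by simp
        moreover have "\<not> P (nat \<bar>z\<bar>)" using False by blast
        ultimately have "\<not> 0 < nat \<bar>z\<bar>" by (metis P_def)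
        then show "x \<in> {0}" by (simp add: z)
      qed
      moreover have "0 \<in> M" using M by (simp add: submod_over_def)
      ultimately have "M = {0}" by blast
      then have "M = submod_over (*) (range of_int) hull M" using M by (simp add: hull_same)
      then show ?thesis using \<open>M = {0}\<close> by (metis finite.emptyI finite_insert)
    qed
  qed
qed

text \<open>Hilbert's basis theorem. The \<open>S\<close>-modules \<open>T n\<close> spanned by the powers of \<open>x\<close> below \<open>x ^ n\<close>
  play the role of the polynomials of degree less than \<open>n\<close>, which makes leading coefficients
  available although \<open>x\<close> may be algebraic over \<open>S\<close>.\<close>

lemma noetherian_adjoin:
  fixes S :: "'a::comm_ring_1 set"
  assumes S: "noetherian_subring S"
  shows "noetherian_over (*) (subring hull (insert x S)) (subring hull (insert x S))"
proof -
  have Sr: "subring S" using S by simp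
  define T where "T n = submod_over (*) S hull ((^) x ` {..<n})" for n :: nat
  have T: "submod_over (*) S (T n)" for n unfolding T_def by (rule submod_hull)
  have T_mono: "T m \<subseteq> T n" if "m \<le> n" for m n
    unfolding T_def by (rule hull_mono) (use that in auto)
  have pow_T: "x ^ i \<in> T n" if "i < n" for i n
    unfolding T_def by (rule hull_inc) (use that in auto)
  have T_Suc: "\<exists>s\<in>S. \<exists>w\<in>T n. y = s * x ^ n + w" if "y \<in> T (Suc n)" for y n
    using that unfolding T_def
    by (intro module.submod_hull_insert[OF module_times Sr]) (simp add: lessThan_Suc)
  have vimage_T: "submod_over (*) S {y. z * y \<in> T n}" for z n
    by (rule module.submod_vimage_linear[OF module_times T])
      (simp_all add: distrib_left mult.left_commute)
  have pow_mult_T: "x ^ m * y \<in> T (m + n)" if "y \<in> T n" for m n y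
  proof -
    have "T n \<subseteq> {y. x ^ m * y \<in> T (m + n)}"
      unfolding T_def[of n]
    proof (rule hull_minimal)
      show "(^) x ` {..<n} \<subseteq> {y. x ^ m * y \<in> T (m + n)}"
        by (auto simp flip: power_add intro!: pow_T)
    qed (rule vimage_T)
    then show ?thesis using that by blast
  qed
  \<comment> \<open>Products add the degree bounds. The previous fact treats a power of
    \<open>x\<close> as one factor; linearity in that factor gives the rest.\<close>
  have mult_T: "z * y \<in> T (m + n)" if "y \<in> T m" "z \<in> T n" for y z m n
  proof -
    have "T m \<subseteq> {y. z * y \<in> T (m + n)}"
      unfolding T_def[of m]
    proof (rule hull_minimal)
      show "(^) x ` {..<m} \<subseteq> {y. z * y \<in> T (m + n)}"
      proof clarify
        fix i assume "i < m"
        then show "z * x ^ i \<in> T (m + n)"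
          using pow_mult_T[OF \<open>z \<in> T n\<close>, of i] T_mono[of "i + n" "m + n"]
          by (auto simp: mult.commute)
      qed
    qed (rule vimage_T)
    then show ?thesis using that by blast
  qed
  define R where "R = subring hull (insert x S)"
  have Rr: "subring R" unfolding R_def by (rule subring_hull)
  have xR: "x \<in> R" unfolding R_def by (rule hull_inc) simp
  have SR: "S \<subseteq> R" unfolding R_def using hull_subset[of "insert x S" subring] by auto
  have powR: "x ^ n \<in> R" for n
    using xR Rr by (induction n) (auto simp: subring_def)
  \<comment> \<open>The union of the \<open>T n\<close> is a subring containing \<open>x\<close> and
    \<open>S\<close>, so every element of \<open>R\<close> has some degree bound.\<close>
  have RT: "R \<subseteq> (\<Union>n. T n)"
    unfolding R_def
  proof (rule hull_minimal)
    have "s \<in> T 1" if "s \<in> S" for s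
      using T[of 1] pow_T[of 0 1] that unfolding submod_over_def by force
    moreover have "x \<in> T 2" using pow_T[of 1 2] by simp
    ultimately show "insert x S \<subseteq> (\<Union>n. T n)" by blast
    show "subring (\<Union>n. T n)"
      unfolding subring_def
    proof (intro conjI ballI)
      show "1 \<in> (\<Union>n. T n)" using pow_T[of 0 1] by auto
    next
      fix y assume "y \<in> (\<Union>n. T n)"
      then obtain n where n: "y \<in> T n" by blast
      have "0 \<in> T n" using T by (auto simp: submod_over_def)
      from module.submod_diff[OF module_times Sr T this n] show "- y \<in> (\<Union>n. T n)" by auto
    next
      fix y z assume "y \<in> (\<Union>n. T n)" "z \<in> (\<Union>n. T n)"
      then obtain m n where mn: "y \<in> T m" "z \<in> T n" by blast
      then have "y \<in> T (m + n)" "z \<in> T (m + n)"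
        using T_mono[of m "m + n"] T_mono[of n "m + n"] by auto
      then have "y + z \<in> T (m + n)" using T unfolding submod_over_def by blast
      then show "y + z \<in> (\<Union>n. T n)" by blast
      show "y * z \<in> (\<Union>n. T n)" using mult_T[OF mn(2,1)] by blast
    qed
  qed
  have "noetherian_over (*) R R"
    unfolding noetherian_over_def
  proof (intro allI impI, elim conjE)
    fix I assume I: "submod_over (*) R I" and IR: "I \<subseteq> R"
    have IS: "submod_over (*) S I" using I SR by (rule submod_subset)
    \<comment> \<open>The leading coefficients in degree \<open>n\<close> of elements of
      \<open>I\<close>. Multiplication by powers of \<open>x\<close> makes these ideals increase
      with \<open>n\<close>, so their union is an ideal of \<open>S\<close>.\<close>
    define L where "L n = {s\<in>S. \<exists>w\<in>T n. s * x ^ n + w \<in> I}" for n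
    have L: "submod_over (*) S (L n)" for n
      unfolding L_def by (rule module.submod_leading_coeffs[OF module_times Sr T IS])
    have shift: "\<exists>w\<in>T (m + n). s * x ^ (m + n) + w = x ^ m * (s * x ^ n + w')"
      if "w' \<in> T n" for m n s w'
      by (rule bexI[OF _ pow_mult_T[OF that, of m]]) (simp add: power_add distrib_left mult_ac)
    have L_mono: "L n \<subseteq> L (m + n)" for m n
    proof
      fix s assume "s \<in> L n"
      then obtain w' where w': "s \<in> S" "w' \<in> T n" "s * x ^ n + w' \<in> I" by (auto simp: L_def)
      have "x ^ m * (s * x ^ n + w') \<in> I"
        using I powR w'(3) unfolding submod_over_def by blast
      then show "s \<in> L (m + n)" using shift[OF w'(2), where m = m and s = s] w'(1)
        unfolding L_def by force
    qed
    have L_mono': "L m \<subseteq> L n" if "m \<le> n" for m n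
      using L_mono[of m "n - m"] that by simp
    have "submod_over (*) S (\<Union>n. L n)"
      unfolding submod_over_def
    proof (intro conjI ballI)
      show "0 \<in> (\<Union>n. L n)" using L by (auto simp: submod_over_def)
    next
      fix y z assume "y \<in> (\<Union>n. L n)" "z \<in> (\<Union>n. L n)"
      then obtain m n where mn: "y \<in> L m" "z \<in> L n" by blast
      then have "y \<in> L (m + n)" "z \<in> L (m + n)"
        using L_mono'[of m "m + n"] L_mono'[of n "m + n"] by auto
      then have "y + z \<in> L (m + n)" using L unfolding submod_over_def by blast
      then show "y + z \<in> (\<Union>n. L n)" by blast
    next
      fix s y assume "s \<in> S" "y \<in> (\<Union>n. L n)"
      then show "s * y \<in> (\<Union>n. L n)" using L unfolding submod_over_def by blast
    qed
    moreover have "(\<Union>n. L n) \<subseteq> S" by (auto simp: L_def)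
    ultimately obtain F where F: "finite F" "(\<Union>n. L n) = submod_over (*) S hull F"
      using S unfolding noetherian_over_def by blast
    have "F \<subseteq> (\<Union>n. L n)" unfolding F(2) by (rule hull_subset)
    then have "\<forall>s\<in>F. \<exists>n. s \<in> L n" by blast
    then obtain e where e: "\<forall>s\<in>F. s \<in> L (e s)" by metis
    \<comment> \<open>From degree \<open>N\<close> on, all the finitely many generators
      \<open>F\<close> of the union occur, so no later \<open>L n\<close> exceeds
      \<open>L N\<close>. Inserting \<open>0\<close> covers empty \<open>F\<close>.\<close>
    define N where "N = Max (insert 0 (e ` F))"
    have "e s \<le> N" if "s \<in> F" for s unfolding N_def using F(1) that by (intro Max_ge) auto
    then have "F \<subseteq> L N" using e L_mono' by blast
    then have LN: "L n \<subseteq> L N" for n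
      using hull_minimal[of F "L N" "submod_over (*) S"] L F(2) by blast
    \<comment> \<open>The part of \<open>I\<close> of degree at most \<open>N\<close> is an
      \<open>S\<close>-submodule of a finitely generated module. Its generators \<open>F1\<close>
      will generate \<open>I\<close> over \<open>R\<close>.\<close>
    have "noetherian_over (*) S (T (Suc N))"
      unfolding T_def by (rule module.noetherian_hull_finite[OF module_times S]) simp
    then obtain F1 where F1: "finite F1" "I \<inter> T (Suc N) = submod_over (*) S hull F1"
      using submod_Int[OF IS T] unfolding noetherian_over_def by blast
    define K where "K = submod_over (*) R hull F1"
    have K: "submod_over (*) R K" unfolding K_def by (rule submod_hull)
    have KI: "K \<subseteq> I"
      unfolding K_def using hull_subset[of F1 "submod_over (*) S"] F1(2)
      by (intro hull_minimal I) blast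
    have base: "I \<inter> T (Suc N) \<subseteq> K"
      unfolding F1(2)
    proof (rule hull_minimal)
      show "F1 \<subseteq> K" unfolding K_def by (rule hull_subset)
      show "submod_over (*) S K" using K SR by (rule submod_subset)
    qed
    have "I \<inter> T n \<subseteq> K" for n
    proof (induction n)
      case 0
      then show ?case using base T_mono[of 0 "Suc N"] by blast
    next
      case (Suc n)
      show ?case
      proof (cases "n \<le> N")
        case True
        then show ?thesis using base T_mono[of "Suc n" "Suc N"] by blast
      next
        case False
        \<comment> \<open>The leading coefficient of \<open>y\<close> also occurs in degree
          \<open>N\<close>. Multiplying that element of \<open>K\<close> by \<open>x ^ m\<close> and
          subtracting it from \<open>y\<close> lowers the degree, so the induction hypothesis
          applies.\<close>
        define m where "m = n - N"
        have n: "n = m + N" using False by (simp add: m_def)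
        show ?thesis
        proof
          fix y assume y: "y \<in> I \<inter> T (Suc n)"
          then obtain s w where sw: "s \<in> S" "w \<in> T n" "y = s * x ^ n + w" using T_Suc by blast
          then have "s \<in> L n" using y by (auto simp: L_def)
          then obtain w' where w': "w' \<in> T N" "s * x ^ N + w' \<in> I"
            using LN[of n] by (auto simp: L_def)
          have "s * x ^ N \<in> T (Suc N)"
            using T[of "Suc N"] pow_T[of N "Suc N"] sw(1) by (auto simp: submod_over_def)
          then have "s * x ^ N + w' \<in> T (Suc N)"
            using T[of "Suc N"] w'(1) T_mono[of N "Suc N"] by (auto simp: submod_over_def)
          then have "s * x ^ N + w' \<in> K" using base w' by blast
          then have k: "x ^ m * (s * x ^ N + w') \<in> K"
            using K powR unfolding submod_over_def by blast
          obtain v where v: "v \<in> T n" "s * x ^ n + v = x ^ m * (s * x ^ N + w')"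
            using shift[OF w'(1)] unfolding n by blast
          have "y - (s * x ^ n + v) \<in> I"
            using module.submod_diff[OF module_times Sr IS] y k KI v(2) by auto
          moreover have "w - v \<in> T n" using module.submod_diff[OF module_times Sr T] sw v by blast
          ultimately have "w - v \<in> K" using Suc.IH sw(3) by auto
          then have "(w - v) + (s * x ^ n + v) \<in> K"
            using k v(2) K unfolding submod_over_def by metis
          then show "y \<in> K" using sw by (simp add: add.commute)
        qed
      qed
    qed
    then have "I = K" using KI IR RT by blast
    then show "\<exists>F. finite F \<and> I = submod_over (*) R hull F" unfolding K_def using F1(1) by blast
  qed
  then show ?thesis unfolding R_def .
qed

text \<open>The elements of \<open>E\<close> are adjoined one at a time to the prime
  subring.\<close>

lemma ex_noetherian_subring:
  fixes E :: "'a::comm_ring_1 set"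
  assumes "finite E"
  shows "\<exists>S. noetherian_subring S \<and> E \<subseteq> S"
  using assms
proof (induction E rule: finite_induct)
  case empty
  show ?case using noetherian_prime_subring by blast
next
  case (insert x E)
  then obtain S where S: "noetherian_subring S" "E \<subseteq> S" by blast
  have "insert x S \<subseteq> subring hull (insert x S)" by (rule hull_subset)
  then show ?case
    using noetherian_adjoin[OF S(1), of x] subring_hull[of "insert x S"] S(2) by blast
qed

section \<open>The maps \<open>rho\<close>, the \<open>k\<close>-kernel and a criterion for
  regularity\<close>

unbundle fps_syntax

lemma rho_zero: "rho k i 0 = 0"
  by (simp add: rho_def fps_eq_iff)

lemma rho_add: "rho k i (f + g) = rho k i f + rho k i g"
  by (simp add: rho_def fps_eq_iff)

lemma rho_scale: "rho k i (fps_scale s f) = fps_scale s (rho k i f)"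
  by (simp add: rho_def fps_scale_def fps_eq_iff)

lemma rho_sum: "rho k i (\<Sum>x\<in>X. f x) = (\<Sum>x\<in>X. rho k i (f x))"
  by (induction X rule: infinite_finite_induct) (simp_all add: rho_zero rho_add)

lemma subspace_rho_vimage:
  assumes "fps_module.subspace M"
  shows "fps_module.subspace {f. rho k i f \<in> M}"
  using assms by (simp add: fps_module.subspace_def rho_zero rho_add rho_scale)

lemma k_kernel_subspace: "fps_module.subspace (k_kernel k A)"
  unfolding k_kernel_def by (rule fps_module.subspace_Inter) simp

lemma k_kernel_self: "A \<in> k_kernel k A"
  by (simp add: k_kernel_def)

lemma k_kernel_rho: "i < k \<Longrightarrow> f \<in> k_kernel k A \<Longrightarrow> rho k i f \<in> k_kernel k A"
  by (auto simp: k_kernel_def)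

lemma k_kernel_least:
  "fps_module.subspace M \<Longrightarrow> A \<in> M \<Longrightarrow> (\<And>i f. i < k \<Longrightarrow> f \<in> M \<Longrightarrow> rho k i f \<in> M) \<Longrightarrow> k_kernel k A \<subseteq> M"
  by (auto simp: k_kernel_def)

text \<open>The coefficients needed to express \<open>A\<close> and the action of the \<open>rho k i\<close> in terms of \<open>G\<close> lie in
  a Noetherian subring \<open>S\<close>, so the smallest \<open>rho\<close>-stable \<open>S\<close>-module containing \<open>A\<close> is finitely
  generated over \<open>S\<close>; its generators generate the \<open>k\<close>-kernel over the whole ring.\<close>

lemma k_regular_if_mem_stable_span:
  fixes A :: "'a::comm_ring_1 fps"
  assumes "finite G" and A: "A \<in> fps_module.span G"
    and stable: "\<And>i g. i < k \<Longrightarrow> g \<in> G \<Longrightarrow> rho k i g \<in> fps_module.span G"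
  shows "k_regular k A"
proof -
  obtain a where a: "A = (\<Sum>h\<in>G. fps_scale (a h) h)"
    using A unfolding fps_module.span_finite[OF \<open>finite G\<close>] by blast
  have "\<exists>u. rho k i g = (\<Sum>h\<in>G. fps_scale (u h) h)" if "i < k" "g \<in> G" for i g
    using stable[OF that] unfolding fps_module.span_finite[OF \<open>finite G\<close>] by blast
  then obtain m where m: "\<And>i g. i < k \<Longrightarrow> g \<in> G \<Longrightarrow> rho k i g = (\<Sum>h\<in>G. fps_scale (m i g h) h)"
    by metis
  define E where "E = a ` G \<union> (\<lambda>(i, g, h). m i g h) ` ({..<k} \<times> G \<times> G)"
  have "finite E" using \<open>finite G\<close> by (simp add: E_def)
  then obtain S where S: "noetherian_subring S" "E \<subseteq> S"
    using ex_noetherian_subring by blast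
  have mS: "m i g h \<in> S" if "i < k" "g \<in> G" "h \<in> G" for i g h
    using S(2) that unfolding E_def by force
  define V where "V = submod_over fps_scale S hull G"
  have V: "submod_over fps_scale S V" unfolding V_def by (rule submod_hull)
  have comb: "(\<Sum>h\<in>X. fps_scale (u h) h) \<in> V" if "finite X" "X \<subseteq> G" "\<And>h. h \<in> G \<Longrightarrow> u h \<in> S" for u X
    using that(1,2)
  proof (induction X rule: finite_induct)
    case empty
    then show ?case using V by (simp add: submod_over_def)
  next
    case (insert x X)
    then have "x \<in> V" unfolding V_def by (intro hull_inc) auto
    then have "fps_scale (u x) x \<in> V"
      using V that(3) insert.prems unfolding submod_over_def by blast
    then show ?case using insert V by (simp add: submod_over_def)
  qed
  have "a h \<in> S" if "h \<in> G" for h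
    using S(2) that unfolding E_def by blast
  then have AV: "A \<in> V" unfolding a by (rule comb[OF \<open>finite G\<close> subset_refl])
  have rhoV: "rho k i f \<in> V" if "i < k" "f \<in> V" for i f
  proof -
    have "submod_over fps_scale S hull G \<subseteq> {f. rho k i f \<in> V}"
    proof (rule hull_minimal)
      show "G \<subseteq> {f. rho k i f \<in> V}"
      proof
        fix g assume g: "g \<in> G"
        have "rho k i g \<in> V"
          unfolding m[OF \<open>i < k\<close> g] by (rule comb[OF \<open>finite G\<close> subset_refl mS[OF \<open>i < k\<close> g]])
        then show "g \<in> {f. rho k i f \<in> V}" by simp
      qed
      show "submod_over fps_scale S {f. rho k i f \<in> V}"
        by (rule fps_module.submod_vimage_linear[OF V]) (simp_all add: rho_zero rho_add rho_scale)
    qed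
    then show ?thesis using that by (auto simp: V_def)
  qed
  \<comment> \<open>\<open>W\<close> is the analogue over \<open>S\<close> of the
    \<open>k\<close>-kernel of \<open>A\<close>.\<close>
  define stab where
    "stab M \<longleftrightarrow> submod_over fps_scale S M \<and> (\<forall>i<k. \<forall>f\<in>M. rho k i f \<in> M)" for M
  define W where "W = stab hull {A}"
  have W: "stab W" unfolding W_def by (rule hull_in) (auto simp: stab_def submod_over_def)
  \<comment> \<open>\<open>V\<close> is finitely generated over the Noetherian \<open>S\<close>, so
    its submodule \<open>W\<close> is too.\<close>
  have "W \<subseteq> V" unfolding W_def using AV V rhoV by (intro hull_minimal) (auto simp: stab_def)
  then obtain F where F: "finite F" "W = submod_over fps_scale S hull F"
    using fps_module.noetherian_hull_finite[OF S(1) \<open>finite G\<close>, folded V_def] W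
    unfolding noetherian_over_def stab_def by metis
  have sub_submod: "submod_over fps_scale S M" if "fps_module.subspace M" for M
    using that by (auto simp: submod_over_def fps_module.subspace_def)
  have FW: "F \<subseteq> W" unfolding F(2) by (rule hull_subset)
  have WF: "W \<subseteq> fps_module.span F"
    unfolding F(2) by (intro hull_minimal sub_submod fps_module.subspace_span fps_module.span_superset)
  have "k_kernel k A \<subseteq> fps_module.span F"
  proof (rule k_kernel_least)
    show "A \<in> fps_module.span F" using WF hull_inc[of A "{A}" stab] by (auto simp: W_def)
    fix i f assume i: "i < k" and f: "f \<in> fps_module.span F"
    \<comment> \<open>Generators go to \<open>W\<close> under \<open>rho\<close> because
      \<open>W\<close> is stable, and \<open>W\<close> lies in the span of \<open>F\<close>.\<close>
    have "F \<subseteq> {f. rho k i f \<in> fps_module.span F}"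
      using FW WF W i by (auto simp: stab_def)
    then have "fps_module.span F \<subseteq> {f. rho k i f \<in> fps_module.span F}"
      by (rule fps_module.span_minimal) (intro subspace_rho_vimage fps_module.subspace_span)
    then show "rho k i f \<in> fps_module.span F" using f by blast
  qed (rule fps_module.subspace_span)
  moreover have "W \<subseteq> k_kernel k A"
    unfolding W_def
    by (rule hull_minimal) (auto simp: stab_def k_kernel_self k_kernel_rho
        intro: sub_submod k_kernel_subspace)
  then have "fps_module.span F \<subseteq> k_kernel k A"
    using FW by (intro fps_module.span_minimal k_kernel_subspace) auto
  ultimately show ?thesis unfolding k_regular_def using F(1) by blast
qed

section \<open>How \<open>rho\<close> acts on shifted series and on series in
  \<open>z^k\<close>\<close>

text \<open>Coefficient \<open>r + n * k\<close> of the shifted series is coefficient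
  \<open>r + n * k - a\<close> of \<open>f\<close>, and by the choice of \<open>b\<close> and
  \<open>s\<close> this index equals \<open>s + (n - b) * k\<close> for
  \<open>n \<ge> b\<close>.\<close>

lemma rho_X_power_mult:
  fixes f :: "'a::comm_ring_1 fps"
  assumes "r < k"
  obtains b s where "s < k" "r + b * k = a + s" "rho k r (fps_X ^ a * f) = fps_X ^ b * rho k s f"
proof -
  \<comment> \<open>The ceiling of \<open>(a - r) / k\<close>, that is, the least \<open>b\<close>
    with \<open>r + b * k \<ge> a\<close>.\<close>
  define b where "b = (a + (k - 1 - r)) div k"
  have 1: "b * k \<le> a + (k - 1 - r)" unfolding b_def by simp
  have 2: "a + (k - 1 - r) < b * k + k"
    using assms dividend_less_div_times[of k "a + (k - 1 - r)"] unfolding b_def by (simp add: add.commute)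
  define s where "s = r + b * k - a"
  have s: "r + b * k = a + s" using 2 assms by (simp add: s_def)
  have "s < k" using 1 s assms by simp
  moreover have "rho k r (fps_X ^ a * f) = fps_X ^ b * rho k s f"
  proof (rule fps_ext)
    fix n
    show "rho k r (fps_X ^ a * f) $ n = (fps_X ^ b * rho k s f) $ n"
    proof (cases "n < b")
      case True
      then have "n * k + k \<le> b * k" by (metis Suc_leI mult_Suc add.commute mult_le_mono1)
      then have "r + n * k < a" using s \<open>s < k\<close> by linarith
      then show ?thesis using True by (simp add: rho_def fps_X_power_mult_nth)
    next
      case False
      then obtain q where q: "n = b + q" by (metis le_Suc_ex not_less)
      have "r + n * k = a + (s + q * k)" using s by (simp add: q algebra_simps)
      then show ?thesis using False by (simp add: rho_def fps_X_power_mult_nth q)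
    qed
  qed
  ultimately show thesis using s that by blast
qed

lemma fps_compose_X_power_nth:
  fixes f :: "'a::comm_ring_1 fps"
  assumes "k > 0"
  shows "(f oo fps_X ^ k) $ n = (if k dvd n then f $ (n div k) else 0)"
proof -
  have "(f oo fps_X ^ k) $ n = (\<Sum>i=0..n. if n = k * i then f $ i else 0)"
    by (auto simp: fps_compose_nth simp flip: power_mult intro!: sum.cong)
  also have "\<dots> = (\<Sum>i=0..n. if i = n div k then if k dvd n then f $ i else 0 else 0)"
    using assms by (intro sum.cong) auto
  finally show ?thesis by simp
qed

text \<open>Only exponents divisible by \<open>k\<close> occur in a series in \<open>z^k\<close>,
  and \<open>s + n * k\<close> is one only for \<open>s = 0\<close>.\<close>

lemma rho_compose_X_power:
  fixes f :: "'a::comm_ring_1 fps"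
  assumes "s < k"
  shows "rho k s (f oo fps_X ^ k) = (if s = 0 then f else 0)"
proof (rule fps_ext)
  fix n
  have "k dvd s + n * k \<longleftrightarrow> s = 0" using assms by (auto simp: dvd_add_left_iff dest: dvd_imp_le)
  then show "rho k s (f oo fps_X ^ k) $ n = (if s = 0 then f else 0) $ n"
    using assms by (simp add: rho_def fps_compose_X_power_nth)
qed

lemma fps_of_poly_eq_sum:
  fixes p :: "'a::comm_ring_1 poly"
  assumes "degree p \<le> D"
  shows "fps_of_poly p = (\<Sum>m\<le>D. fps_const (coeff p m) * fps_X ^ m)"
proof -
  have "fps_of_poly p = fps_of_poly (\<Sum>m\<le>D. monom (coeff p m) m)"
    using assms by (simp add: poly_as_sum_of_monoms')
  also have "\<dots> = (\<Sum>m\<le>D. fps_of_poly (monom (coeff p m) m))" by (rule fps_of_poly_sum)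
  finally show ?thesis unfolding fps_of_poly_monom .
qed

section \<open>Existence and uniqueness by recursion on coefficients\<close>

text \<open>For \<open>k \<ge> 2\<close> and \<open>n > 0\<close>, \<open>k * m \<le> n\<close>
  implies \<open>m < n\<close>, so coefficient \<open>n\<close> involves only earlier coefficients
  of \<open>f\<close>. At \<open>n = 0\<close> the term \<open>m = 0\<close> would refer to itself.
  The guard keeps the natural subtraction from truncating.\<close>

lemma fps_of_poly_mult_compose_nth:
  fixes p :: "'a::comm_ring_1 poly"
  assumes "k \<ge> 2" "n > 0"
  shows "(fps_of_poly p * (f oo fps_X ^ k)) $ n =
    (\<Sum>m<n. if k * m \<le> n then coeff p (n - k * m) * f $ m else 0)"
proof -
  have "(fps_of_poly p * (f oo fps_X ^ k)) $ n =
      (\<Sum>l\<le>n. if k dvd l then coeff p (n - l) * f $ (l div k) else 0)"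
    using assms
    by (subst mult.commute, subst fps_mult_nth)
      (auto simp: fps_compose_X_power_nth atLeast0AtMost mult.commute intro!: sum.cong)
  also have "\<dots> = (\<Sum>l\<in>{l\<in>{..n}. k dvd l}. coeff p (n - l) * f $ (l div k))"
    by (rule sum.inter_filter[symmetric]) simp
  also have "\<dots> = (\<Sum>m\<in>{m\<in>{..<n}. k * m \<le> n}. coeff p (n - k * m) * f $ m)"
  proof (rule sum.reindex_bij_witness[of _ "\<lambda>m. k * m" "\<lambda>l. l div k"])
    fix l assume "l \<in> {l \<in> {..n}. k dvd l}"
    moreover from this have "l div k < n"
      using assms by (metis (no_types, lifting) atMost_iff div_le_mono div_less_dividend 
         le_less_trans mem_Collect_eq Suc_1 Suc_le_lessD)
    ultimately show "l div k \<in> {m \<in> {..<n}. k * m \<le> n}" by auto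
  qed (use assms in auto)
  also have "\<dots> = (\<Sum>m<n. if k * m \<le> n then coeff p (n - k * m) * f $ m else 0)"
    by (rule sum.inter_filter) simp
  finally show ?thesis .
qed

text \<open>Coefficients are compared: the condition on \<open>\<alpha>\<close> is the equation at
  \<open>n = 0\<close>, and every later coefficient is determined by earlier ones.\<close>

lemma mahler_solution_iff_coeffs:
  fixes A :: "nat \<Rightarrow> 'a::comm_ring_1 fps"
  assumes k: "k \<ge> 2"
    and \<alpha>: "\<forall>i\<in>{1..d}. \<alpha> i = A i $ 0 + (\<Sum>j=1..d. poly (c i j) 0 * \<alpha> j)"
  shows "mahler_solution k d A c \<alpha> U \<longleftrightarrow>
    (\<forall>i\<in>{1..d}. \<forall>n. U i $ n = (if n = 0 then \<alpha> i else A i $ n +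
      (\<Sum>j=1..d. \<Sum>m<n. if k * m \<le> n then coeff (c i j) (n - k * m) * U j $ m else 0)))"
    (is "_ \<longleftrightarrow> ?rec")
proof -
  have rhs: "(A i + (\<Sum>j=1..d. fps_of_poly (c i j) * (U j oo fps_X ^ k))) $ n =
      (if n = 0 then \<alpha> i else A i $ n +
        (\<Sum>j=1..d. \<Sum>m<n. if k * m \<le> n then coeff (c i j) (n - k * m) * U j $ m else 0))"
    if init: "\<forall>i\<in>{1..d}. U i $ 0 = \<alpha> i" and i: "i \<in> {1..d}" for i n
  proof (cases "n = 0")
    case True
    then show ?thesis
      using bspec[OF \<alpha> i] init k by (simp add: fps_sum_nth poly_0_coeff_0 fps_compose_X_power_nth)
  next
    case False
    then show ?thesis using k by (simp add: fps_sum_nth fps_of_poly_mult_compose_nth)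
  qed
  show ?thesis
  proof
    assume sol: "mahler_solution k d A c \<alpha> U"
    then have init: "\<forall>i\<in>{1..d}. U i $ 0 = \<alpha> i"
      unfolding mahler_solution_def by blast
    show ?rec
    proof (intro ballI allI)
      fix i n assume i: "i \<in> {1..d}"
      have "U i = A i + (\<Sum>j=1..d. fps_of_poly (c i j) * (U j oo fps_X ^ k))"
        using sol i unfolding mahler_solution_def by blast
      from arg_cong[where f = "\<lambda>f. f $ n", OF this] rhs[OF init i, of n]
      show "U i $ n = (if n = 0 then \<alpha> i else A i $ n +
        (\<Sum>j=1..d. \<Sum>m<n. if k * m \<le> n then coeff (c i j) (n - k * m) * U j $ m else 0))"
        by (rule trans)
    qed
  next
    assume rec: ?rec
    then have init: "\<forall>i\<in>{1..d}. U i $ 0 = \<alpha> i" by simp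
    show "mahler_solution k d A c \<alpha> U"
      unfolding mahler_solution_def
    proof (intro conjI init ballI fps_ext)
      fix i n assume i: "i \<in> {1..d}"
      show "U i $ n = (A i + (\<Sum>j=1..d. fps_of_poly (c i j) * (U j oo fps_X ^ k))) $ n"
        unfolding rhs[OF init i] using rec i by blast
    qed
  qed
qed

fun mahler_coeff ::
    "nat \<Rightarrow> nat \<Rightarrow> (nat \<Rightarrow> 'a::comm_ring_1 fps) \<Rightarrow> (nat \<Rightarrow> nat \<Rightarrow> 'a poly) \<Rightarrow> (nat \<Rightarrow> 'a)
      \<Rightarrow> nat \<Rightarrow> nat \<Rightarrow> 'a" where
  "mahler_coeff k d A c \<alpha> n i = (if n = 0 then \<alpha> i else A i $ n +
     (\<Sum>j=1..d. \<Sum>m<n. if k * m \<le> n then coeff (c i j) (n - k * m) * mahler_coeff k d A c \<alpha> m j else 0))"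

declare mahler_coeff.simps [simp del]

text \<open>Gives existence and uniqueness together. The components are coupled, so the induction on
  \<open>n\<close> is over all of them at once.\<close>

lemma mahler_solution_iff:
  fixes A :: "nat \<Rightarrow> 'a::comm_ring_1 fps"
  assumes k: "k \<ge> 2"
    and \<alpha>: "\<forall>i\<in>{1..d}. \<alpha> i = A i $ 0 + (\<Sum>j=1..d. poly (c i j) 0 * \<alpha> j)"
  shows "mahler_solution k d A c \<alpha> U \<longleftrightarrow>
    (\<forall>i\<in>{1..d}. U i = Abs_fps (\<lambda>n. mahler_coeff k d A c \<alpha> n i))"
  unfolding mahler_solution_iff_coeffs[OF assms]
proof
  assume rec: "\<forall>i\<in>{1..d}. \<forall>n. U i $ n = (if n = 0 then \<alpha> i else A i $ n +
      (\<Sum>j=1..d. \<Sum>m<n. if k * m \<le> n then coeff (c i j) (n - k * m) * U j $ m else 0))"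
  have "U i $ n = mahler_coeff k d A c \<alpha> n i" if "i \<in> {1..d}" for i n
    using that
  proof (induction n arbitrary: i rule: less_induct)
    case (less n)
    have "U i $ n = (if n = 0 then \<alpha> i else A i $ n +
      (\<Sum>j=1..d. \<Sum>m<n. if k * m \<le> n then coeff (c i j) (n - k * m) * U j $ m else 0))"
      using rec less.prems by blast
    also have "\<dots> = mahler_coeff k d A c \<alpha> n i"
      unfolding mahler_coeff.simps[of k d A c \<alpha> n i]
      by (intro if_cong refl arg_cong2[where f = "(+)"] sum.cong) (use less.IH in auto)
    finally show ?case .
  qed
  then show "\<forall>i\<in>{1..d}. U i = Abs_fps (\<lambda>n. mahler_coeff k d A c \<alpha> n i)"
    by (simp add: fps_eq_iff)
next
  assume U: "\<forall>i\<in>{1..d}. U i = Abs_fps (\<lambda>n. mahler_coeff k d A c \<alpha> n i)"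
  then have Un: "U i $ n = mahler_coeff k d A c \<alpha> n i" if "i \<in> {1..d}" for i n
    using that by simp
  show "\<forall>i\<in>{1..d}. \<forall>n. U i $ n = (if n = 0 then \<alpha> i else A i $ n +
      (\<Sum>j=1..d. \<Sum>m<n. if k * m \<le> n then coeff (c i j) (n - k * m) * U j $ m else 0))"
  proof (intro ballI allI)
    fix i n assume i: "i \<in> {1..d}"
    show "U i $ n = (if n = 0 then \<alpha> i else A i $ n +
      (\<Sum>j=1..d. \<Sum>m<n. if k * m \<le> n then coeff (c i j) (n - k * m) * U j $ m else 0))"
      unfolding Un[OF i] mahler_coeff.simps[of k d A c \<alpha> n i]
      by (intro if_cong refl arg_cong2[where f = "(+)"] sum.cong) (auto simp: Un)
  qed
qed

section \<open>Regularity of the solutions\<close>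

text \<open>With \<open>D\<close> bounding the degrees of the \<open>c i j\<close>, the span of the \<open>z\<^sup>a h\<close> with \<open>a \<le> D\<close> and \<open>h\<close> a
  generator of some \<open>k\<close>-kernel of \<open>A j\<close> or some \<open>U j\<close> is stable: \<open>rho\<close> applied to
  \<open>z\<^sup>a z\<^sup>m U l (z ^ k)\<close> gives \<open>0\<close> or \<open>z\<^sup>b U l\<close> with \<open>b \<le> (a + m) / k \<le> 2 D / k \<le> D\<close>.\<close>

lemma mahler_solution_k_regular:
  fixes A :: "nat \<Rightarrow> 'a::comm_ring_1 fps"
  assumes k: "k \<ge> 2" and A: "\<And>i. i \<in> {1..d} \<Longrightarrow> k_regular k (A i)"
    and U: "\<And>i. i \<in> {1..d} \<Longrightarrow> U i = A i + (\<Sum>j=1..d. fps_of_poly (c i j) * (U j oo fps_X ^ k))"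
    and i0: "i0 \<in> {1..d}"
  shows "k_regular k (U i0)"
proof -
  obtain B where B: "\<And>i. i \<in> {1..d} \<Longrightarrow> finite (B i)"
    "\<And>i. i \<in> {1..d} \<Longrightarrow> k_kernel k (A i) = fps_module.span (B i)"
    using A unfolding k_regular_def by metis
  \<comment> \<open>A sum serves as a common bound for all the degrees.\<close>
  define D where "D = (\<Sum>i=1..d. \<Sum>j=1..d. degree (c i j))"
  have D: "degree (c i j) \<le> D" if "i \<in> {1..d}" "j \<in> {1..d}" for i j
  proof -
    have "degree (c i j) \<le> (\<Sum>j=1..d. degree (c i j))"
      using that by (intro member_le_sum) auto
    also have "\<dots> \<le> D" unfolding D_def
      using that by (intro member_le_sum[of i _ "\<lambda>i. \<Sum>j=1..d. degree (c i j)"]) auto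
    finally show ?thesis .
  qed
  define H where "H = (\<Union>i\<in>{1..d}. B i) \<union> U ` {1..d}"
  have "finite H" using B(1) by (simp add: H_def)
  define G where "G = (\<lambda>(a, h). fps_X ^ a * h) ` ({..D} \<times> H)"
  have GI: "fps_X ^ a * h \<in> fps_module.span G" if "a \<le> D" "h \<in> H" for a h
    using that by (intro fps_module.span_base) (force simp: G_def)
  have pow_B: "fps_X ^ a * f \<in> fps_module.span G"
    if "a \<le> D" "j \<in> {1..d}" "f \<in> k_kernel k (A j)" for a j f
  proof -
    have "fps_module.span (B j) \<subseteq> {f. fps_X ^ a * f \<in> fps_module.span G}"
    proof (rule fps_module.span_minimal)
      show "B j \<subseteq> {f. fps_X ^ a * f \<in> fps_module.span G}"
        using that(1,2) by (intro subsetI CollectI GI) (auto simp: H_def)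
      have "fps_X ^ a * fps_scale s f = fps_scale s (fps_X ^ a * f)" for s :: 'a and f
        by (simp add: fps_scale_def mult.left_commute)
      then show "fps_module.subspace {f. fps_X ^ a * f \<in> fps_module.span G}"
        unfolding fps_module.subspace_def
        by (simp add: fps_module.span_zero fps_module.span_add fps_module.span_scale distrib_left)
    qed
    then show ?thesis using that B(2) by auto
  qed
  have rho_ker: "rho k r (fps_X ^ a * f) \<in> fps_module.span G"
    if "r < k" "a \<le> D" "j \<in> {1..d}" "f \<in> k_kernel k (A j)" for r a j f
  proof -
    obtain b s where bs: "s < k" "r + b * k = a + s" "rho k r (fps_X ^ a * f) = fps_X ^ b * rho k s f"
      using rho_X_power_mult[OF \<open>r < k\<close>] by metis
    \<comment> \<open>The exponent must not grow, so that \<open>fps_X ^ b\<close> remains within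
      the bound \<open>D\<close>; \<open>rho k s f\<close> stays in the kernel.\<close>
    have "b \<le> a"
    proof (rule ccontr)
      assume "\<not> b \<le> a"
      then have "(a + 1) * k \<le> b * k" by (intro mult_right_mono) auto
      moreover have "a * 1 \<le> a * k" using k by (intro mult_left_mono) auto
      ultimately show False using bs(1,2) by (simp add: algebra_simps)
    qed
    then show ?thesis
      unfolding bs(3) using that bs(1) by (intro pow_B[of _ j] k_kernel_rho) auto
  qed
  \<comment> \<open>The bound \<open>2 * D\<close> allows for a shift \<open>a \<le> D\<close> and a
    monomial of degree at most \<open>D\<close> from some \<open>c j l\<close>.\<close>
  have rho_comp: "rho k r (fps_X ^ e * (U l oo fps_X ^ k)) \<in> fps_module.span G"
    if "r < k" "e \<le> 2 * D" "l \<in> {1..d}" for r e l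
  proof -
    obtain b s where bs: "s < k" "r + b * k = e + s"
      "rho k r (fps_X ^ e * (U l oo fps_X ^ k)) = fps_X ^ b * rho k s (U l oo fps_X ^ k)"
      using rho_X_power_mult[OF \<open>r < k\<close>] by metis
    show ?thesis
    proof (cases "s = 0")
      case True
      have "b * 2 \<le> b * k" using k by (intro mult_left_mono) auto
      then have "b \<le> D" using bs(2) True that(2) by linarith
      then show ?thesis
        unfolding bs(3) using True bs(1) that(3) by (simp add: rho_compose_X_power GI H_def)
    next
      case False
      then show ?thesis
        unfolding bs(3) using bs(1) by (simp add: rho_compose_X_power fps_module.span_zero)
    qed
  qed
  have rho_U: "rho k r (fps_X ^ a * U j) \<in> fps_module.span G"
    if "r < k" "a \<le> D" "j \<in> {1..d}" for r a j
  proof -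
    \<comment> \<open>The functional equation replaces \<open>U j\<close> by terms on which
      \<open>rho\<close> is known: a kernel element and shifted series in
      \<open>z^k\<close>.\<close>
    have "fps_X ^ a * U j = fps_X ^ a * A j + (\<Sum>l=1..d. \<Sum>m\<le>D.
        fps_scale (coeff (c j l) m) (fps_X ^ (a + m) * (U l oo fps_X ^ k)))"
    proof -
      have "fps_X ^ a * U j = fps_X ^ a * A j
          + (\<Sum>l=1..d. fps_X ^ a * (fps_of_poly (c j l) * (U l oo fps_X ^ k)))"
        by (subst U[OF that(3)]) (simp add: distrib_left sum_distrib_left)
      also have "(\<Sum>l=1..d. fps_X ^ a * (fps_of_poly (c j l) * (U l oo fps_X ^ k))) =
        (\<Sum>l=1..d. \<Sum>m\<le>D. fps_scale (coeff (c j l) m) (fps_X ^ (a + m) * (U l oo fps_X ^ k)))"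
        by (intro sum.cong refl, subst fps_of_poly_eq_sum[OF D])
          (use that in \<open>auto simp: sum_distrib_left sum_distrib_right fps_scale_def power_add mult_ac\<close>)
      finally show ?thesis .
    qed
    then have "rho k r (fps_X ^ a * U j) = rho k r (fps_X ^ a * A j) + (\<Sum>l=1..d. \<Sum>m\<le>D.
        fps_scale (coeff (c j l) m) (rho k r (fps_X ^ (a + m) * (U l oo fps_X ^ k))))"
      by (simp add: rho_add rho_sum rho_scale)
    also have "\<dots> \<in> fps_module.span G"
      using that
      by (intro fps_module.span_add fps_module.span_sum fps_module.span_scale
          rho_ker[of _ _ j] rho_comp k_kernel_self) auto
    finally show ?thesis .
  qed
  show ?thesis
  proof (rule k_regular_if_mem_stable_span)
    show "finite G" using \<open>finite H\<close> by (simp add: G_def)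
    show "U i0 \<in> fps_module.span G" using GI[of 0 "U i0"] i0 by (simp add: H_def)
    fix r g assume r: "r < k" and "g \<in> G"
    then obtain a h where ah: "a \<le> D" "h \<in> H" "g = fps_X ^ a * h" by (auto simp: G_def)
    from ah(2) consider j where "j \<in> {1..d}" "h \<in> B j" | j where "j \<in> {1..d}" "h = U j"
      unfolding H_def by blast
    then show "rho k r g \<in> fps_module.span G"
    proof cases
      case 1
      then have "h \<in> k_kernel k (A j)" using B(2) by (simp add: fps_module.span_base)
      then show ?thesis using rho_ker r ah 1 by blast
    next
      case 2
      then show ?thesis using rho_U r ah by blast
    qed
  qed
qed

theorem mainTheorem5:
  fixes k d :: nat
    and A :: "nat \<Rightarrow> 'a::comm_ring_1 fps"
    and c :: "nat \<Rightarrow> nat \<Rightarrow> 'a poly"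
    and \<alpha> :: "nat \<Rightarrow> 'a"
  assumes "k \<ge> 2"
    and "\<And>i. i \<in> {1..d} \<Longrightarrow> k_regular k (A i)"
    and "\<And>i. i \<in> {1..d} \<Longrightarrow> \<alpha> i = fps_nth (A i) 0 + (\<Sum>j=1..d. poly (c i j) 0 * \<alpha> j)"
  shows "(\<exists>!U. U \<in> {1..d} \<rightarrow>\<^sub>E UNIV \<and> mahler_solution k d A c \<alpha> U) \<and>
         (\<forall>U. mahler_solution k d A c \<alpha> U \<longrightarrow> (\<forall>i\<in>{1..d}. k_regular k (U i)))"
proof (intro conjI allI impI ballI)
  have "\<forall>i\<in>{1..d}. \<alpha> i = A i $ 0 + (\<Sum>j=1..d. poly (c i j) 0 * \<alpha> j)"
    using assms(3) by blast
  note iff = mahler_solution_iff[OF assms(1) this]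
  show "\<exists>!U. U \<in> {1..d} \<rightarrow>\<^sub>E UNIV \<and> mahler_solution k d A c \<alpha> U"
  proof (rule ex1I)
    \<comment> \<open>The tuple given by the recursion, made extensional so that uniqueness also
      holds outside \<open>{1..d}\<close>.\<close>
    show "(\<lambda>i\<in>{1..d}. Abs_fps (\<lambda>n. mahler_coeff k d A c \<alpha> n i)) \<in> {1..d} \<rightarrow>\<^sub>E UNIV \<and>
        mahler_solution k d A c \<alpha> (\<lambda>i\<in>{1..d}. Abs_fps (\<lambda>n. mahler_coeff k d A c \<alpha> n i))"
      unfolding iff by simp
  next
    fix U assume "U \<in> {1..d} \<rightarrow>\<^sub>E UNIV \<and> mahler_solution k d A c \<alpha> U"
    then show "U = (\<lambda>i\<in>{1..d}. Abs_fps (\<lambda>n. mahler_coeff k d A c \<alpha> n i))"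
      by (intro PiE_ext[of U "{1..d}" "\<lambda>_. UNIV"]) (auto simp: iff)
  qed
next
  fix U i assume "mahler_solution k d A c \<alpha> U" and i: "i \<in> {1..d}"
  then have "\<And>i. i \<in> {1..d} \<Longrightarrow>
      U i = A i + (\<Sum>j=1..d. fps_of_poly (c i j) * (U j oo fps_X ^ k))"
    unfolding mahler_solution_def by blast
  then show "k_regular k (U i)"
    using assms(1,2) i by (intro mahler_solution_k_regular[of k d A U c i]) auto
qed

end
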